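(* For every positive integer $L$, $$\sum_{n\ge 0}b_2(L,n)q^n=q^2\frac{1-q^{L-1}}{1-q}(-q^2;q)_{L-2}.$$
   Context: A partition of $n$ is a non-increasing finite sequence of positive integers summing to $n$ (the empty partition is the unique partition of $0$). Its Young diagram has $\lambda_i$ left-justified cells in row $i$; with $\lambda'_j$ the number of cells in column $j$, the hook length of cell $(i,j)$ is $h(i,j)=\lambda_i+\lambda'_j-i-j+1$. For a positive integer $L$, $b_2(L,n)$ is the total number of cells of hook length $2$, summed over all partitions of $n$ into distinct parts with largest part at most $L$. Here $(a;q)_N=\prod_{k=0}^{N-1}(1-aq^k)$ for $N\ge 0$, and for $N<0$ the standard convention $(a;q)_{N}=1/(aq^{N};q)_{-N}$ is used (so for $L=1$ the right-hand side is $0$). The identity is one of formal power series in $q$. *)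

theory Defs
  imports "HOL-Computational_Algebra.Formal_Laurent_Series"
begin

definition is_partition :: "nat list \<Rightarrow> nat \<Rightarrow> bool" where
  "is_partition lam n \<longleftrightarrow> sorted_wrt (\<ge>) lam \<and> (\<forall>p\<in>set lam. 0 < p) \<and> sum_list lam = n"

text \<open>Rows and columns are counted from 1, so row \<open>i\<close> has length \<open>lam ! (i - 1)\<close>.\<close>

definition young_diagram :: "nat list \<Rightarrow> (nat \<times> nat) set" where
  "young_diagram lam = {(i, j). 1 \<le> i \<and> i \<le> length lam \<and> 1 \<le> j \<and> j \<le> lam ! (i - 1)}"

definition column_length :: "nat list \<Rightarrow> nat \<Rightarrow> nat" where
  "column_length lam j = card {i. (i, j) \<in> young_diagram lam}"

definition hook_length :: "nat list \<Rightarrow> nat \<times> nat \<Rightarrow> int" where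
  "hook_length lam = (\<lambda>(i, j). int (lam ! (i - 1)) + int (column_length lam j) - int i - int j + 1)"

definition distinct_partitions_le :: "nat \<Rightarrow> nat \<Rightarrow> nat list set" where
  "distinct_partitions_le L n = {lam. is_partition lam n \<and> distinct lam \<and> (\<forall>p\<in>set lam. p \<le> L)}"

lemma finite_distinct_partitions_le: "finite (distinct_partitions_le L n)"
proof (rule finite_subset)
  show "distinct_partitions_le L n \<subseteq> {lam. set lam \<subseteq> {..L} \<and> distinct lam}"
    by (auto simp: distinct_partitions_le_def)
  show "finite {lam. set lam \<subseteq> {..L} \<and> distinct lam}"
    by (simp add: finite_subset_distinct)
qed

lemma finite_young_diagram: "finite (young_diagram lam)"
proof (rule finite_subset)
  show "young_diagram lam \<subseteq> (SIGMA i:{1..length lam}. {1..lam ! (i - 1)})"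
    by (auto simp: young_diagram_def)
qed auto

definition b2 :: "nat \<Rightarrow> nat \<Rightarrow> nat" where
  "b2 L n = (\<Sum>lam\<in>distinct_partitions_le L n. card {c \<in> young_diagram lam. hook_length lam c = 2})"

text \<open>The \<open>q\<close>-shifted factorial for integer index; for \<open>N < 0\<close> it is
  \<open>1 / (a q^N; q)_{-N}\<close>. Negative powers of \<open>q\<close> occur here, so formal power series
  identities involving it are stated in the field of formal Laurent series.\<close>

definition qpoch :: "'a::field \<Rightarrow> 'a \<Rightarrow> int \<Rightarrow> 'a" where
  "qpoch a q N =
     (if 0 \<le> N then \<Prod>k<nat N. 1 - a * q ^ k
      else 1 / (\<Prod>k<nat (- N). 1 - (a * q powi N) * q ^ k))"

end

theory Submission
  imports Defs
begin

text \<open>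
  In a partition into distinct parts no cell of hook length 2 has a leg, so these cells sit next to
  the last cell of the rows of length \<open>p \<ge> 2\<close> for which \<open>p - 1\<close> is not a part. Sorting the
  sets of parts by whether they contain the largest admissible part \<open>L + 1\<close> gives
  \<open>F(L+1) = (1 + q^(L+1)) F(L) + q^(L+1) (1 + q) \<dots> (1 + q^(L-1))\<close>, which the right-hand side
  satisfies as well.
\<close>

text \<open>The bound \<open>2 \<le> p\<close> excludes the part 1: its predecessor 0 is never a
  part, yet a row of length 1 has no cell next to its last one.\<close>

definition isolated_parts :: "nat set \<Rightarrow> nat set" where
  "isolated_parts S = {p \<in> S. 2 \<le> p \<and> p - 1 \<notin> S}"

section \<open>Cells of hook length 2 and isolated parts\<close>

lemma bij_betw_nth_pred:
  assumes "distinct xs"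
  shows "bij_betw (\<lambda>i. xs ! (i - 1)) {1..length xs} (set xs)"
proof -
  have "bij_betw (\<lambda>i. i - 1) {1..length xs} {..<length xs}"
    by (rule bij_betwI[where g = Suc]) auto
  from bij_betw_trans[OF this bij_betw_nth[OF assms refl refl]] show ?thesis
    by (simp add: o_def)
qed

lemma bij_betw_nth_pred_filter:
  assumes "distinct xs"
  shows "bij_betw (\<lambda>i. xs ! (i - 1)) {i \<in> {1..length xs}. P (xs ! (i - 1))} {x \<in> set xs. P x}"
proof (rule bij_betw_subset[OF bij_betw_nth_pred[OF assms]])
  have "(\<lambda>i. xs ! (i - 1)) ` {1..length xs} = set xs"
    using bij_betw_nth_pred[OF assms] by (rule bij_betw_imp_surj_on)
  then show "(\<lambda>i. xs ! (i - 1)) ` {i \<in> {1..length xs}. P (xs ! (i - 1))} = {x \<in> set xs. P x}"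
    by (simp only: set_eq_iff image_iff mem_Collect_eq Bex_def) metis
qed (rule Collect_restrict)

text \<open>Column \<open>j\<close> meets exactly the rows of length at least \<open>j\<close>, and
  distinctness lets rows be counted as parts.\<close>

lemma column_length_eq:
  assumes "distinct lam" and "1 \<le> j"
  shows "column_length lam j = card {r \<in> set lam. j \<le> r}"
proof -
  have "bij_betw (\<lambda>i. lam ! (i - 1)) {i \<in> {1..length lam}. j \<le> lam ! (i - 1)} {r \<in> set lam. j \<le> r}"
    using bij_betw_nth_pred_filter[OF assms(1)] .
  moreover have "{i \<in> {1..length lam}. j \<le> lam ! (i - 1)} = {i. (i, j) \<in> young_diagram lam}"
    using assms(2) by (auto simp: young_diagram_def)
  ultimately show ?thesis
    by (metis bij_betw_same_card column_length_def)
qed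

text \<open>The parts decrease strictly, so those not below the \<open>i\<close>-th one fill exactly
  the rows 1 to \<open>i\<close>.\<close>

lemma card_parts_ge_nth:
  fixes lam :: "nat list"
  assumes "distinct lam" "sorted_wrt (\<ge>) lam" "1 \<le> i" "i \<le> length lam"
  shows "card {r \<in> set lam. lam ! (i - 1) \<le> r} = i"
proof -
  have lt: "lam ! b < lam ! a" if "a < b" "b < length lam" for a b
    using sorted_wrt_nth_less[OF assms(2) that] nth_eq_iff_index_eq[OF assms(1), of a b] that
    by (simp add: order_less_le)
  have "{k \<in> {1..length lam}. lam ! (i - 1) \<le> lam ! (k - 1)} = {1..i}"
  proof (intro set_eqI iffI)
    fix k assume k: "k \<in> {k \<in> {1..length lam}. lam ! (i - 1) \<le> lam ! (k - 1)}"
    then show "k \<in> {1..i}"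
      using lt[of "i - 1" "k - 1"] assms(3) by (cases "k \<le> i") (simp_all, linarith)
  next
    fix k assume k: "k \<in> {1..i}"
    then show "k \<in> {k \<in> {1..length lam}. lam ! (i - 1) \<le> lam ! (k - 1)}"
      using lt[of "k - 1" "i - 1"] assms(4) by (cases "k = i") (simp_all, linarith)
  qed
  moreover have "bij_betw (\<lambda>k. lam ! (k - 1)) {k \<in> {1..length lam}. lam ! (i - 1) \<le> lam ! (k - 1)}
      {r \<in> set lam. lam ! (i - 1) \<le> r}"
    using bij_betw_nth_pred_filter[OF assms(1)] .
  ultimately show ?thesis
    by (metis bij_betw_same_card card_atLeastAtMost diff_Suc_1)
qed

text \<open>Of the parts of size at least \<open>j\<close>, those not below the length of row
  \<open>i\<close> account for \<open>i\<close> rows, which cancels \<open>- int i\<close>. The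
  remaining ones, in the interval, form the leg of the cell.\<close>

lemma hook_length_eq:
  assumes "distinct lam" "sorted_wrt (\<ge>) lam" "(i, j) \<in> young_diagram lam"
  shows "hook_length lam (i, j) =
    int (lam ! (i - 1)) - int j + 1 + int (card (set lam \<inter> {j..<lam ! (i - 1)}))"
proof -
  let ?p = "lam ! (i - 1)"
  have ij: "1 \<le> i" "i \<le> length lam" "1 \<le> j" "j \<le> ?p"
    using assms(3) by (auto simp: young_diagram_def)
  have "{r \<in> set lam. j \<le> r} = {r \<in> set lam. ?p \<le> r} \<union> (set lam \<inter> {j..<?p})"
    using ij by auto
  then have "card {r \<in> set lam. j \<le> r} = card {r \<in> set lam. ?p \<le> r} + card (set lam \<inter> {j..<?p})"
    by (simp only:) (rule card_Un_disjoint, auto)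
  then have "column_length lam j = i + card (set lam \<inter> {j..<?p})"
    using column_length_eq[OF assms(1) ij(3)] card_parts_ge_nth[OF assms(1,2) ij(1,2)] by simp
  then show ?thesis
    by (simp add: hook_length_def)
qed

lemma hook_length_eq_2_iff:
  assumes "distinct lam" "sorted_wrt (\<ge>) lam" "(i, j) \<in> young_diagram lam"
  shows "hook_length lam (i, j) = 2 \<longleftrightarrow> lam ! (i - 1) = j + 1 \<and> j \<notin> set lam"
proof -
  let ?p = "lam ! (i - 1)"
  have jp: "j \<le> ?p"
    using assms(3) by (auto simp: young_diagram_def)
  \<comment> \<open>The arm has 0, 1 or at least 2 cells. In the first case the interval is empty
    and the hook length is 1, in the last it is at least 3; only an arm of one cell with no leg
    gives 2.\<close>
  consider "?p = j" | "?p = j + 1" | "?p \<ge> j + 2"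
    using jp by linarith
  then show ?thesis
  proof cases
    case 2
    then have "{j..<?p} = {j}" by auto
    then show ?thesis
      using 2 by (cases "j \<in> set lam") (auto simp: hook_length_eq[OF assms])
  qed (auto simp: hook_length_eq[OF assms])
qed

text \<open>Such a cell determines and is determined by its row, since its column is the row length
  minus 1; distinct rows have distinct lengths, so the row length serves as bijection.\<close>

lemma card_hook_length_2:
  assumes "distinct lam" "sorted_wrt (\<ge>) lam"
  shows "card {c \<in> young_diagram lam. hook_length lam c = 2} = card (isolated_parts (set lam))"
proof (rule bij_betw_same_card)
  let ?C = "{c \<in> young_diagram lam. hook_length lam c = 2}"
  have C: "(i, j) \<in> ?C \<longleftrightarrow>
      i \<in> {1..length lam} \<and> 1 \<le> j \<and> lam ! (i - 1) = j + 1 \<and> j \<notin> set lam" for i j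
    using hook_length_eq_2_iff[OF assms, of i j] by (auto simp: young_diagram_def)
  show "bij_betw (\<lambda>c. lam ! (fst c - 1)) ?C (isolated_parts (set lam))"
    unfolding bij_betw_def
  proof (intro conjI inj_onI set_eqI iffI)
    fix c d assume "c \<in> ?C" "d \<in> ?C" and eq: "lam ! (fst c - 1) = lam ! (fst d - 1)"
    moreover obtain i j i' j' where "c = (i, j)" "d = (i', j')"
      by (metis surj_pair)
    ultimately show "c = d"
      using inj_onD[OF bij_betw_imp_inj_on[OF bij_betw_nth_pred[OF assms(1)]], of i i']
        C[of i j] C[of i' j'] by simp
  next
    fix p assume "p \<in> (\<lambda>c. lam ! (fst c - 1)) ` ?C"
    then obtain i j where ij: "(i, j) \<in> ?C" and p: "p = lam ! (i - 1)"
      by force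
    then have "lam ! (i - 1) \<in> set lam"
      using C[of i j] by (intro nth_mem) auto
    then show "p \<in> isolated_parts (set lam)"
      using ij p C[of i j] by (simp add: isolated_parts_def)
  next
    fix p assume p: "p \<in> isolated_parts (set lam)"
    then have "p \<in> (\<lambda>i. lam ! (i - 1)) ` {1..length lam}"
      using bij_betw_nth_pred[OF assms(1)] by (simp add: bij_betw_def isolated_parts_def)
    then obtain i where i: "i \<in> {1..length lam}" "p = lam ! (i - 1)"
      by blast
    then have "(i, p - 1) \<in> ?C"
      using p C[of i "p - 1"] by (auto simp: isolated_parts_def)
    then show "p \<in> (\<lambda>c. lam ! (fst c - 1)) ` ?C"
      using i(2) by force
  qed
qed

section \<open>Partitions into distinct parts as sets of parts\<close>

lemma bij_betw_set_distinct_partitions_le: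
  "bij_betw set (distinct_partitions_le L n) {S \<in> Pow {1..L}. \<Sum>S = n}"
proof (rule bij_betwI[where g = "\<lambda>S. rev (sorted_list_of_set S)"])
  show "set \<in> distinct_partitions_le L n \<rightarrow> {S \<in> Pow {1..L}. \<Sum>S = n}"
    by (auto simp: distinct_partitions_le_def is_partition_def Suc_le_eq
        distinct_sum_list_conv_Sum)
  show "(\<lambda>S. rev (sorted_list_of_set S)) \<in> {S \<in> Pow {1..L}. \<Sum>S = n} \<rightarrow> distinct_partitions_le L n"
  proof (rule Pi_I)
    fix S assume S: "S \<in> {S \<in> Pow {1..L}. \<Sum>S = n}"
    then have "finite S"
      using finite_subset by blast
    with S show "rev (sorted_list_of_set S) \<in> distinct_partitions_le L n"
      by (auto simp: distinct_partitions_le_def is_partition_def sorted_wrt_rev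
          distinct_sum_list_conv_Sum)
  qed
  show "rev (sorted_list_of_set (set lam)) = lam" if "lam \<in> distinct_partitions_le L n" for lam
  proof -
    have "sorted (rev lam)" "distinct (rev lam)"
      using that by (auto simp: distinct_partitions_le_def is_partition_def sorted_wrt_rev)
    then have "sorted_list_of_set (set (rev lam)) = rev lam"
      by (metis sorted_list_of_set.idem_if_sorted_distinct)
    then show ?thesis
      by simp
  qed
  show "set (rev (sorted_list_of_set S)) = S" if "S \<in> {S \<in> Pow {1..L}. \<Sum>S = n}" for S
    using that finite_subset[of S "{1..L}"] by auto
qed

lemma b2_eq: "b2 L n = (\<Sum>S | S \<in> Pow {1..L} \<and> \<Sum>S = n. card (isolated_parts S))"
proof -
  have "b2 L n = (\<Sum>lam\<in>distinct_partitions_le L n. card (isolated_parts (set lam)))"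
    unfolding b2_def
    by (rule sum.cong) (auto simp: distinct_partitions_le_def is_partition_def card_hook_length_2)
  also have "\<dots> = (\<Sum>S | S \<in> Pow {1..L} \<and> \<Sum>S = n. card (isolated_parts S))"
    using sum.reindex_bij_betw[OF bij_betw_set_distinct_partitions_le, of "\<lambda>S. card (isolated_parts S)"]
    by simp
  finally show ?thesis .
qed

text \<open>Summing over all subsets of \<open>{1..L}\<close> at once, not weight by weight, gives a
  finite sum that can be split by the largest admissible part.\<close>

definition isolated_gf :: "nat \<Rightarrow> rat fps" where
  "isolated_gf L = (\<Sum>S\<in>Pow {1..L}. of_nat (card (isolated_parts S)) * fps_X ^ \<Sum>S)"

lemma Abs_fps_b2: "Abs_fps (\<lambda>n. of_nat (b2 L n)) = isolated_gf L"
proof (rule fps_ext)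
  fix n
  have "(\<Sum>S\<in>Pow {1..L}. of_nat (card (isolated_parts S)) * fps_X ^ \<Sum>S) $ n
      = (\<Sum>S\<in>Pow {1..L}. if \<Sum>S = n then of_nat (card (isolated_parts S)) else (0 :: rat))"
    unfolding fps_sum_nth
    by (rule sum.cong) (auto simp flip: fps_of_nat)
  also have "\<dots> = of_nat (b2 L n)"
    unfolding b2_eq of_nat_sum by (rule sum.inter_filter[symmetric]) simp
  finally show "Abs_fps (\<lambda>n. of_nat (b2 L n)) $ n = isolated_gf L $ n"
    by (simp add: isolated_gf_def)
qed

section \<open>Recursion on the bound for the parts\<close>

lemma sum_Pow_atLeastAtMost_Suc:
  fixes f :: "nat set \<Rightarrow> 'a::comm_monoid_add"
  shows "(\<Sum>S\<in>Pow {1..Suc n}. f S) = (\<Sum>S\<in>Pow {1..n}. f S) + (\<Sum>S\<in>Pow {1..n}. f (insert (Suc n) S))"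
proof -
  have "Pow {1..Suc n} = Pow {1..n} \<union> insert (Suc n) ` Pow {1..n}"
    by (simp only: atLeastAtMostSuc_conv[of 1 n] le_add1 plus_1_eq_Suc Pow_insert)
  moreover have "inj_on (insert (Suc n)) (Pow {1..n})"
    by (rule inj_onI) (metis Pow_iff atLeastAtMost_iff insert_ident not_less_eq_eq order_refl subsetD)
  moreover have "Pow {1..n} \<inter> insert (Suc n) ` Pow {1..n} = {}"
    by auto
  ultimately show ?thesis
    by (simp add: sum.union_disjoint sum.reindex)
qed

lemma sum_insert_Suc:
  assumes "S \<subseteq> {1..n}"
  shows "\<Sum>(insert (Suc n) S) = Suc n + \<Sum>S"
proof -
  have "finite S" "Suc n \<notin> S"
    using assms finite_subset by auto
  then show ?thesis
    by simp
qed

lemma sum_Pow_fps_X: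
  "(\<Sum>S\<in>Pow {1..n}. fps_X ^ \<Sum>S :: 'a::comm_ring_1 fps) = (\<Prod>k=1..n. 1 + fps_X ^ k)"
proof (induction n)
  case (Suc n)
  have "(\<Sum>S\<in>Pow {1..Suc n}. fps_X ^ \<Sum>S :: 'a fps)
      = (\<Sum>S\<in>Pow {1..n}. fps_X ^ \<Sum>S) + (\<Sum>S\<in>Pow {1..n}. fps_X ^ Suc n * fps_X ^ \<Sum>S)"
    unfolding sum_Pow_atLeastAtMost_Suc
    by (intro arg_cong2[of _ _ _ _ "(+)"] sum.cong refl)
      (simp only: Pow_iff sum_insert_Suc power_add)
  also have "\<dots> = (1 + fps_X ^ Suc n) * (\<Sum>S\<in>Pow {1..n}. fps_X ^ \<Sum>S)"
    by (simp only: sum_distrib_left[symmetric] distrib_right mult_1_left)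
  finally show ?case
    by (simp only: Suc.IH) (simp add: mult.commute)
qed simp

text \<open>Isolation of a part looks only at its predecessor, so a new maximum leaves the status of
  the old parts unchanged and is itself isolated iff \<open>n\<close> is absent.\<close>

lemma isolated_parts_insert_Suc:
  assumes "S \<subseteq> {1..n}" and "1 \<le> n"
  shows "isolated_parts (insert (Suc n) S) =
    (if n \<in> S then isolated_parts S else insert (Suc n) (isolated_parts S))"
proof -
  have le: "p \<le> n" if "p \<in> S" for p
    using assms(1) that by auto
  show ?thesis
    using assms(2) le[of "Suc n"] by (auto simp: isolated_parts_def dest: le)
qed

lemma card_isolated_parts_insert_Suc:
  assumes "S \<subseteq> {1..n}" and "1 \<le> n"
  shows "card (isolated_parts (insert (Suc n) S)) =
    card (isolated_parts S) + (if n \<in> S then 0 else 1)"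
proof -
  have "isolated_parts S \<subseteq> {1..n}"
    using assms(1) by (auto simp: isolated_parts_def)
  then have "finite (isolated_parts S)" "Suc n \<notin> isolated_parts S"
    using finite_subset by auto
  then show ?thesis
    by (simp add: isolated_parts_insert_Suc[OF assms])
qed

text \<open>The sets without \<open>m + 2\<close> contribute \<open>isolated_gf (Suc m)\<close>.
  Adjoining \<open>m + 2\<close> multiplies this by \<open>fps_X ^ (m + 2)\<close> and counts one
  more part for each set avoiding \<open>m + 1\<close>; those sets yield the product.\<close>

lemma isolated_gf_rec:
  "isolated_gf (Suc (Suc m)) =
    (1 + fps_X ^ Suc (Suc m)) * isolated_gf (Suc m) + fps_X ^ Suc (Suc m) * (\<Prod>k=1..m. 1 + fps_X ^ k)"
proof -
  let ?n = "Suc m" and ?X = "fps_X :: rat fps"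
  let ?c = "\<lambda>S. of_nat (card (isolated_parts S)) :: rat fps"
  have "(\<Sum>S\<in>Pow {1..?n}. ?c (insert (Suc ?n) S) * ?X ^ \<Sum>(insert (Suc ?n) S))
      = (\<Sum>S\<in>Pow {1..?n}. ?X ^ Suc ?n * (?c S * ?X ^ \<Sum>S)
          + ?X ^ Suc ?n * (if ?n \<in> S then 0 else ?X ^ \<Sum>S))"
  proof (rule sum.cong)
    fix S assume "S \<in> Pow {1..?n}"
    then have S: "S \<subseteq> {1..?n}"
      by blast
    show "?c (insert (Suc ?n) S) * ?X ^ \<Sum>(insert (Suc ?n) S)
        = ?X ^ Suc ?n * (?c S * ?X ^ \<Sum>S) + ?X ^ Suc ?n * (if ?n \<in> S then 0 else ?X ^ \<Sum>S)"
      unfolding sum_insert_Suc[OF S] card_isolated_parts_insert_Suc[OF S le_add1[of 1 m, unfolded plus_1_eq_Suc]]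
      by (simp add: power_add algebra_simps)
  qed simp
  also have "\<dots> = ?X ^ Suc ?n * isolated_gf ?n
      + ?X ^ Suc ?n * (\<Sum>S\<in>Pow {1..?n}. if ?n \<in> S then 0 else ?X ^ \<Sum>S)"
    by (simp only: sum.distrib sum_distrib_left isolated_gf_def)
  \<comment> \<open>The subsets of \<open>{1..m + 1}\<close> that avoid \<open>m + 1\<close> are the
    subsets of \<open>{1..m}\<close>.\<close>
  also have "(\<Sum>S\<in>Pow {1..?n}. if ?n \<in> S then 0 else ?X ^ \<Sum>S) = (\<Sum>S\<in>Pow {1..m}. ?X ^ \<Sum>S)"
    by (rule sum.mono_neutral_cong_right) (auto simp: le_Suc_eq)
  finally have "(\<Sum>S\<in>Pow {1..?n}. ?c (insert (Suc ?n) S) * ?X ^ \<Sum>(insert (Suc ?n) S))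
      = ?X ^ Suc ?n * isolated_gf ?n + ?X ^ Suc ?n * (\<Prod>k=1..m. 1 + ?X ^ k)"
    by (simp only: sum_Pow_fps_X)
  then show ?thesis
    unfolding isolated_gf_def[of "Suc ?n"] sum_Pow_atLeastAtMost_Suc[of _ ?n]
    by (simp only: isolated_gf_def[symmetric] distrib_right mult_1_left add.assoc)
qed

lemma isolated_gf_1: "isolated_gf 1 = 0"
proof -
  have "isolated_parts S = {}" if "S \<subseteq> {1}" for S
    using that by (auto simp: isolated_parts_def)
  then show ?thesis
    by (simp add: isolated_gf_def)
qed

text \<open>With \<open>L = m + 2\<close> the index \<open>L - 2\<close> is a natural number, and
  multiplying by \<open>1 - fps_X\<close> avoids division of power series.\<close>

lemma isolated_gf_closed_form:
  "(1 - fps_X) * isolated_gf (m + 2) =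
    fps_X ^ 2 * (1 - fps_X ^ (m + 1)) * (\<Prod>k<m. 1 + fps_X ^ (k + 2))"
proof (induction m)
  case 0
  then show ?case
    using isolated_gf_rec[of 0] isolated_gf_1 by (simp add: numeral_2_eq_2 mult.commute)
next
  case (Suc m)
  let ?X = "fps_X :: rat fps" and ?P = "\<Prod>k<m. 1 + (fps_X :: rat fps) ^ (k + 2)"
  have P: "(\<Prod>k=1..Suc m. 1 + ?X ^ k) = (1 + ?X) * ?P"
    unfolding prod.atLeast_Suc_atMost_Suc_shift One_nat_def atMost_atLeast0[symmetric]
      lessThan_Suc_atMost[symmetric] prod.lessThan_Suc_shift
    by simp
  have "(1 - ?X) * isolated_gf (Suc m + 2)
      = (1 + ?X ^ (m + 3)) * ((1 - ?X) * isolated_gf (m + 2)) + (1 - ?X) * ?X ^ (m + 3) * ((1 + ?X) * ?P)"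
    using isolated_gf_rec[of "Suc m"] unfolding P by (simp add: algebra_simps eval_nat_numeral)
  \<comment> \<open>Apart from the common factor \<open>?X ^ 2 * ?P\<close>, both sides expand to
    \<open>1 - ?X ^ (2 * m + 4)\<close>.\<close>
  also have "\<dots> = ?X ^ 2 * (1 - ?X ^ (Suc m + 1)) * ((1 + ?X ^ (m + 2)) * ?P)"
    unfolding Suc.IH by (simp add: algebra_simps power_add power2_eq_square power3_eq_cube)
  finally show ?case
    by (simp add: mult.commute)
qed

theorem theorem2p2:
  fixes L :: nat
  assumes "L \<ge> 1"
  shows "fps_to_fls (Abs_fps (\<lambda>n. of_nat (b2 L n)) :: rat fps) =
    fls_X ^ 2 * ((1 - fls_X ^ (L - 1)) / (1 - fls_X)) * qpoch (- (fls_X ^ 2)) fls_X (int L - 2)"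
proof (cases "L = 1")
  case True
  then show ?thesis
    \<comment> \<open>Here \<open>fls_X ^ (L - 1)\<close> is 1, so the numerator on the right
      vanishes, as does the left-hand side.\<close>
    by (simp add: Abs_fps_b2 isolated_gf_1[simplified])
next
  case False
  then obtain m where L: "L = m + 2"
    using assms by (metis One_nat_def add.commute le_Suc_ex numeral_2_eq_2 not_less_eq_eq le_antisym)
  let ?X = "fls_X :: rat fls"
  have ne: "1 - ?X \<noteq> 0"
  proof
    assume "1 - ?X = 0"
    then have "fls_nth (1 - ?X) 0 = 0" by simp
    then show False by simp
  qed
  \<comment> \<open>The index equals \<open>m\<close>, so the first branch of \<open>qpoch\<close>
    applies; the sign of its first argument turns each factor into a sum.\<close>
  have q: "qpoch (- (?X ^ 2)) ?X (int L - 2) = (\<Prod>k<m. 1 + ?X ^ (k + 2))"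
    by (simp add: qpoch_def L power_add power2_eq_square mult_ac)
  have prod: "fps_to_fls (\<Prod>k<m. 1 + fps_X ^ (k + 2)) = (\<Prod>k<m. 1 + ?X ^ (k + 2))"
    by (induction m) (simp_all add: fls_times_fps_to_fls fps_to_fls_power)
  have "(1 - ?X) * fps_to_fls (isolated_gf L) = fps_to_fls ((1 - fps_X) * isolated_gf L)"
    by (simp add: fls_times_fps_to_fls)
  also have "\<dots> = ?X ^ 2 * (1 - ?X ^ (L - 1)) * (\<Prod>k<m. 1 + ?X ^ (k + 2))"
    unfolding L isolated_gf_closed_form fls_times_fps_to_fls prod
    by (simp add: fls_times_fps_to_fls fps_to_fls_power)
  finally show ?thesis
    using ne by (simp add: Abs_fps_b2 q field_simps)
qed

end
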